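(* Let $d\ge2$. The map $d_{AW^r}:\mathcal{S}_{rc}^d\times\mathcal{S}_{rc}^d\to[0,1]$ defined by $$d_{AW^r}(A_1,A_2)=\sup_{j\in\mathbb{N}}\min\Big\{\tfrac1j,\ \sup_{\|x\|\le j}|d_r(x,A_1)-d_r(x,A_2)|\Big\}$$ is a metric on $\mathcal{S}_{rc}^d$ that is compatible with (i.e. induces) the radial Attouch-Wets topology $\tau_{AW^r}$. Furthermore, $(\mathcal{S}_{rc}^d,d_{AW^r})$ is a complete metric space.
   Context: $\mathbb{N}=\{1,2,\dots\}$; $B_2^d$ and $\mathbb{S}^{d-1}$ are the closed Euclidean unit ball and the unit sphere of $\mathbb{R}^d$. A star set is a non-empty $A\subseteq\mathbb{R}^d$ with $ta\in A$ for all $a\in A$, $0\le t\le 1$. Its radial function is $\rho_A:\mathbb{S}^{d-1}\to[0,\infty]$, $\rho_A(\theta)=\sup\{\lambda\ge 0:\lambda\theta\in A\}$. A star body is a star set $A$ that is radially closed: $\rho_A(\theta)\theta\in A$ whenever $\rho_A(\theta)<\infty$ (it may be unbounded or non-closed). $\mathcal{S}_{rc}^d$ is the family of all star bodies in $\mathbb{R}^d$. The radial sum $A_1\tilde{+}A_2$ is the star body with radial function $\rho_{A_1}+\rho_{A_2}$. The radial distance from $x\in\mathbb{R}^d$ to $A\in\mathcal{S}_{rc}^d$ is $d_r(x,A)=\inf\{\alpha>0: x\in A\tilde{+}\alpha B_2^d\}\in[0,\infty)$. The map $A\mapsto d_r(\cdot,A)$ from $\mathcal{S}_{rc}^d$ to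 the space $F(\mathbb{R}^d,\mathbb{R})$ of all functions $\mathbb{R}^d\to\mathbb{R}$ is injective; the radial Attouch-Wets topology $\tau_{AW^r}$ is the topology that $\mathcal{S}_{rc}^d$ inherits, under this identification, from $F(\mathbb{R}^d,\mathbb{R})$ endowed with the topology of uniform convergence on bounded subsets of $\mathbb{R}^d$. *)

theory Defs
  imports "HOL-Analysis.Analysis"
begin

definition star_set :: "'a::real_vector set \<Rightarrow> bool" where
  "star_set A \<longleftrightarrow> A \<noteq> {} \<and> (\<forall>a\<in>A. \<forall>t\<in>{0..1}. t *\<^sub>R a \<in> A)"

(* Meaningful, and used, only at unit vectors. *)
definition radial_fun :: "'a::real_vector set \<Rightarrow> 'a \<Rightarrow> ennreal" where
  "radial_fun A \<theta> = (SUP l\<in>{l::real. 0 \<le> l \<and> l *\<^sub>R \<theta> \<in> A}. ennreal l)"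

definition star_body :: "'a::real_normed_vector set \<Rightarrow> bool" where
  "star_body A \<longleftrightarrow> star_set A \<and>
     (\<forall>\<theta>\<in>sphere 0 1. radial_fun A \<theta> < \<infinity> \<longrightarrow> enn2real (radial_fun A \<theta>) *\<^sub>R \<theta> \<in> A)"

definition star_bodies :: "'a::real_normed_vector set set" where
  "star_bodies = {A. star_body A}"

lemma star_set_zero: "star_set A \<Longrightarrow> 0 \<in> A"
proof -
  assume A: "star_set A"
  then obtain a where "a \<in> A" by (auto simp: star_set_def)
  moreover have "(0::real) \<in> {0..1}" by simp
  ultimately have "(0::real) *\<^sub>R a \<in> A" using A unfolding star_set_def by blast
  then show ?thesis by simp
qed

lemma star_body_scaleR_mem_iff:
  assumes "star_body A" "\<theta> \<in> sphere 0 1" "0 \<le> l"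
  shows "l *\<^sub>R \<theta> \<in> A \<longleftrightarrow> ennreal l \<le> radial_fun A \<theta>"
proof
  assume "l *\<^sub>R \<theta> \<in> A"
  then show "ennreal l \<le> radial_fun A \<theta>"
    unfolding radial_fun_def using assms(3) by (intro SUP_upper) auto
next
  assume le: "ennreal l \<le> radial_fun A \<theta>"
  have A: "star_set A" using assms(1) by (simp add: star_body_def)
  show "l *\<^sub>R \<theta> \<in> A"
  proof (cases "ennreal l < radial_fun A \<theta>")
    case True
    then obtain m where m: "0 \<le> m" "m *\<^sub>R \<theta> \<in> A" "ennreal l < ennreal m"
      unfolding radial_fun_def less_SUP_iff by auto
    then have "l < m" using assms(3) by (simp add: ennreal_less_iff)
    then have "l / m \<in> {0..1}" using assms(3) by simp
    then have "(l / m) *\<^sub>R (m *\<^sub>R \<theta>) \<in> A"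
      using A m(2) unfolding star_set_def by blast
    then show ?thesis using \<open>l < m\<close> assms(3) by simp
  next
    case False
    then have "radial_fun A \<theta> = ennreal l" using le by simp
    then have "enn2real (radial_fun A \<theta>) = l" "radial_fun A \<theta> < \<infinity>"
      using assms(3) by simp_all
    then show ?thesis using assms(1,2) by (auto simp: star_body_def)
  qed
qed

lemma star_body_eqI:
  assumes "star_body A" "star_body B"
    and "\<And>\<theta>. \<theta> \<in> sphere 0 1 \<Longrightarrow> radial_fun A \<theta> = radial_fun B \<theta>"
  shows "A = B"
proof (rule set_eqI)
  fix x
  show "x \<in> A \<longleftrightarrow> x \<in> B"
  proof (cases "x = 0")
    case True
    then show ?thesis using assms(1,2) star_set_zero by (auto simp: star_body_def)
  next
    case False
    then have s: "sgn x \<in> sphere 0 1" by (simp add: norm_sgn)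
    have "norm x *\<^sub>R sgn x = x" using False by (simp add: sgn_div_norm)
    then show ?thesis
      using star_body_scaleR_mem_iff[OF assms(1) s, of "norm x"]
        star_body_scaleR_mem_iff[OF assms(2) s, of "norm x"] assms(3)[OF s] by simp
  qed
qed

lemma star_body_exists:
  fixes r :: "'a::real_normed_vector \<Rightarrow> ennreal"
  shows "\<exists>C. star_body C \<and> (\<forall>\<theta>\<in>sphere 0 1. radial_fun C \<theta> = r \<theta>)"
proof -
  define C where "C = {x. x = 0 \<or> ennreal (norm x) \<le> r (sgn x)}"
  have C: "l *\<^sub>R \<theta> \<in> C \<longleftrightarrow> ennreal l \<le> r \<theta>" if "\<theta> \<in> sphere 0 1" "0 \<le> l" for \<theta> l
    using that by (cases "l = 0") (auto simp: C_def sgn_scaleR sgn_div_norm)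
  have rad: "radial_fun C \<theta> = r \<theta>" if \<theta>: "\<theta> \<in> sphere 0 1" for \<theta>
  proof (rule antisym)
    show "radial_fun C \<theta> \<le> r \<theta>"
      unfolding radial_fun_def using C[OF \<theta>] by (intro SUP_least) auto
    show "r \<theta> \<le> radial_fun C \<theta>"
    proof (rule dense_le)
      fix y assume y: "y < r \<theta>"
      then have "y < top" by (metis less_le_trans top_greatest)
      then obtain l where l: "y = ennreal l" "0 \<le> l" by (cases y) auto
      then have "l *\<^sub>R \<theta> \<in> C" using y C[OF \<theta> l(2)] by simp
      then show "y \<le> radial_fun C \<theta>"
        unfolding radial_fun_def l(1) using l(2) by (intro SUP_upper) auto
    qed
  qed
  have "star_set C"
    unfolding star_set_def
  proof (intro conjI ballI)
    show "C \<noteq> {}" by (auto simp: C_def)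
    fix a :: 'a and t :: real assume a: "a \<in> C" and t: "t \<in> {0..1}"
    show "t *\<^sub>R a \<in> C"
    proof (cases "t = 0 \<or> a = 0")
      case False
      then have "ennreal (norm (t *\<^sub>R a)) \<le> ennreal (norm a)"
        using t by (intro ennreal_leI) (auto simp: mult_left_le_one_le)
      also have "\<dots> \<le> r (sgn a)" using a False by (auto simp: C_def)
      also have "sgn a = sgn (t *\<^sub>R a)" using False t by (simp add: sgn_scaleR)
      finally show ?thesis by (simp add: C_def)
    qed (auto simp: C_def)
  qed
  moreover have "enn2real (radial_fun C \<theta>) *\<^sub>R \<theta> \<in> C"
    if "\<theta> \<in> sphere 0 1" "radial_fun C \<theta> < \<infinity>" for \<theta>
    using C[OF that(1), of "enn2real (radial_fun C \<theta>)"] rad[OF that(1)] that(2)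
    by (simp add: less_top)
  ultimately have "star_body C" by (simp add: star_body_def)
  then show ?thesis using rad by blast
qed

definition radial_sum :: "'a::real_normed_vector set \<Rightarrow> 'a set \<Rightarrow> 'a set" where
  "radial_sum A B = (THE C. star_body C \<and>
     (\<forall>\<theta>\<in>sphere 0 1. radial_fun C \<theta> = radial_fun A \<theta> + radial_fun B \<theta>))"

lemma radial_sum:
  "star_body (radial_sum A B)"
  "\<theta> \<in> sphere 0 1 \<Longrightarrow> radial_fun (radial_sum A B) \<theta> = radial_fun A \<theta> + radial_fun B \<theta>"
proof -
  let ?P = "\<lambda>C. star_body C \<and>
     (\<forall>\<theta>\<in>sphere 0 1. radial_fun C \<theta> = radial_fun A \<theta> + radial_fun B \<theta>)"
  have "C = D" if "?P C" "?P D" for C D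
    using that by (intro star_body_eqI) simp_all
  then have "\<exists>!C. ?P C"
    using star_body_exists[of "\<lambda>\<theta>. radial_fun A \<theta> + radial_fun B \<theta>"] by blast
  from theI'[OF this] have "?P (radial_sum A B)" unfolding radial_sum_def .
  then show "star_body (radial_sum A B)"
    "\<theta> \<in> sphere 0 1 \<Longrightarrow> radial_fun (radial_sum A B) \<theta> = radial_fun A \<theta> + radial_fun B \<theta>"
    by auto
qed

definition radial_dist :: "'a::real_normed_vector \<Rightarrow> 'a set \<Rightarrow> real" where
  "radial_dist x A = Inf {\<alpha>. \<alpha> > 0 \<and> x \<in> radial_sum A ((*\<^sub>R) \<alpha> ` cball 0 1)}"

lemma mem_radial_sum_ball:
  assumes "norm x \<le> \<alpha>" "\<alpha> > 0"
  shows "x \<in> radial_sum A ((*\<^sub>R) \<alpha> ` cball 0 1)"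
proof (cases "x = 0")
  case True
  then show ?thesis using radial_sum(1) star_set_zero by (auto simp: star_body_def)
next
  case False
  then have s: "sgn x \<in> sphere 0 1" by (simp add: norm_sgn)
  have "norm x *\<^sub>R sgn x \<in> (*\<^sub>R) \<alpha> ` cball 0 1"
    using assms by (intro image_eqI[of _ _ "x /\<^sub>R \<alpha>"]) (auto simp: sgn_div_norm field_simps)
  then have "ennreal (norm x) \<le> radial_fun ((*\<^sub>R) \<alpha> ` cball 0 1) (sgn x)"
    unfolding radial_fun_def by (intro SUP_upper) auto
  then have "ennreal (norm x) \<le> radial_fun (radial_sum A ((*\<^sub>R) \<alpha> ` cball 0 1)) (sgn x)"
    unfolding radial_sum(2)[OF s] by (metis add_increasing zero_le)
  then have "norm x *\<^sub>R sgn x \<in> radial_sum A ((*\<^sub>R) \<alpha> ` cball 0 1)"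
    using star_body_scaleR_mem_iff[OF radial_sum(1) s] by simp
  moreover have "norm x *\<^sub>R sgn x = x" using False by (simp add: sgn_div_norm)
  ultimately show ?thesis by simp
qed

(* The infimum is over a non-empty set bounded below; the upper bound also makes the
   real suprema below genuine ones. *)
lemma radial_dist_nonneg: "0 \<le> radial_dist x A"
  unfolding radial_dist_def
proof (rule cInf_greatest)
  have "norm x + 1 \<in> {\<alpha>. \<alpha> > 0 \<and> x \<in> radial_sum A ((*\<^sub>R) \<alpha> ` cball 0 1)}"
    using mem_radial_sum_ball[of x "norm x + 1" A] add_nonneg_pos[of "norm x" 1] by simp
  then show "{\<alpha>. \<alpha> > 0 \<and> x \<in> radial_sum A ((*\<^sub>R) \<alpha> ` cball 0 1)} \<noteq> {}" by blast
qed simp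

lemma radial_dist_le_norm: "radial_dist x A \<le> norm x"
proof (rule field_le_epsilon)
  fix e :: real assume "e > 0"
  then show "radial_dist x A \<le> norm x + e"
    unfolding radial_dist_def
    by (intro cInf_lower mem_radial_sum_ball CollectI conjI bdd_belowI[of _ 0])
      (auto intro: add_nonneg_pos)
qed

definition unif_conv_bounded_topology :: "('a::metric_space \<Rightarrow> real) topology" where
  "unif_conv_bounded_topology = topology (\<lambda>U. \<forall>f\<in>U. \<exists>B e. bounded B \<and> e > 0 \<and>
     {g. \<forall>x\<in>B. \<bar>g x - f x\<bar> < e} \<subseteq> U)"

lemma openin_unif_conv_bounded_topology:
  "openin unif_conv_bounded_topology U \<longleftrightarrow>
     (\<forall>f\<in>U. \<exists>B e. bounded B \<and> e > 0 \<and> {g. \<forall>x\<in>B. \<bar>g x - f x\<bar> < e} \<subseteq> U)"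
proof -
  let ?P = "\<lambda>U. \<forall>f\<in>U. \<exists>B e. bounded B \<and> e > 0 \<and> {g. \<forall>x\<in>B. \<bar>g x - f x\<bar> < e} \<subseteq> U"
  have "istopology (?P :: ('a \<Rightarrow> real) set \<Rightarrow> bool)"
    unfolding istopology_def
  proof (intro conjI allI impI)
    fix S T :: "('a \<Rightarrow> real) set"
    assume S: "?P S" and T: "?P T"
    show "?P (S \<inter> T)"
    proof
      fix f assume "f \<in> S \<inter> T"
      then obtain B e B' e' where
        "bounded B" "e > 0" "{g. \<forall>x\<in>B. \<bar>g x - f x\<bar> < e} \<subseteq> S"
        "bounded B'" "e' > 0" "{g. \<forall>x\<in>B'. \<bar>g x - f x\<bar> < e'} \<subseteq> T"
        using S T by (meson IntD1 IntD2)
      then show "\<exists>B e. bounded B \<and> e > 0 \<and> {g. \<forall>x\<in>B. \<bar>g x - f x\<bar> < e} \<subseteq> S \<inter> T"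
        by (intro exI[of _ "B \<union> B'"] exI[of _ "min e e'"]) auto
    qed
  next
    fix K :: "('a \<Rightarrow> real) set set"
    assume K: "\<forall>S\<in>K. ?P S"
    show "?P (\<Union>K)"
    proof
      fix f assume "f \<in> \<Union>K"
      then obtain S where "S \<in> K" "f \<in> S" by blast
      then obtain B e where "bounded B" "e > 0" "{g. \<forall>x\<in>B. \<bar>g x - f x\<bar> < e} \<subseteq> S"
        using K by meson
      then show "\<exists>B e. bounded B \<and> e > 0 \<and> {g. \<forall>x\<in>B. \<bar>g x - f x\<bar> < e} \<subseteq> \<Union>K"
        using \<open>S \<in> K\<close> by (meson Union_upper order_trans)
    qed
  qed
  then show ?thesis by (simp add: unif_conv_bounded_topology_def)
qed

definition radial_AW_topology :: "'a::real_normed_vector set topology" where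
  "radial_AW_topology =
     pullback_topology star_bodies (\<lambda>A x. radial_dist x A) unif_conv_bounded_topology"

(* Extended by 0 outside the star bodies, since the locale Metric_space requires
   non-negativity and symmetry on the whole type. *)
definition radial_AW_dist :: "'a::real_normed_vector set \<Rightarrow> 'a set \<Rightarrow> real" where
  "radial_AW_dist A B =
     (if A \<in> star_bodies \<and> B \<in> star_bodies
      then SUP j\<in>{1::nat..}. min (1 / real j)
             (SUP x\<in>cball 0 (real j). \<bar>radial_dist x A - radial_dist x B\<bar>)
      else 0)"

end

(* For a star body A one has d_r(x, A) = |x| - min(|x|, rho_A(x/|x|)), so A is the zero set
   of d_r(., A), and d_AW(A, B) <= c says exactly that for every j either 1/j <= c or the
   two distance functions differ by at most c on the ball of radius j. The metric axioms
   and the comparison of topologies follow from this. For completeness, a Cauchy sequence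
   of star bodies A_n has distance functions converging uniformly on bounded sets, and
   since r |-> min(l, r) is continuous and monotone, the star body with radial function
   liminf rho_{A_n} has the limit function as its distance function. *)
theory Submission
  imports Defs
begin

section \<open>The radial distance in terms of the radial function\<close>

lemma radial_fun_scaled_ball:
  fixes \<theta> :: "'a::real_normed_vector"
  assumes "\<theta> \<in> sphere 0 1" "\<alpha> > 0"
  shows "radial_fun ((*\<^sub>R) \<alpha> ` cball 0 1) \<theta> = ennreal \<alpha>"
proof -
  have "(*\<^sub>R) \<alpha> ` cball (0::'a) 1 = cball 0 \<alpha>"
    using cball_scale[of \<alpha> "0::'a" 1] assms(2) by simp
  then show ?thesis
    using assms unfolding radial_fun_def
    by (intro antisym SUP_least SUP_upper) (auto intro: ennreal_leI)
qed

lemma radial_dist_zero [simp]: "radial_dist 0 A = 0"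
  using radial_dist_nonneg[of 0 A] radial_dist_le_norm[of 0 A] by simp

text \<open>On the ray through x, membership in the radial sum reads |x| \<le> rho_A + \<alpha>, so
  the infimum is the positive part of |x| - rho_A. Truncating rho_A at |x| keeps the argument of
  \<open>enn2real\<close> finite where rho_A is infinite, and makes the formula hold at x = 0, where
  \<open>sgn x\<close> is not a unit vector.\<close>

lemma radial_dist_eq:
  assumes "star_body A"
  shows "radial_dist x A = norm x - enn2real (min (ennreal (norm x)) (radial_fun A (sgn x)))"
proof (cases "x = 0")
  case True
  then show ?thesis by (simp add: min_def)
next
  case False
  then have s: "sgn x \<in> sphere 0 1" by (simp add: norm_sgn)
  have x: "norm x *\<^sub>R sgn x = x" using False by (simp add: sgn_div_norm)
  define m where "m = enn2real (min (ennreal (norm x)) (radial_fun A (sgn x)))"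
  have m: "ennreal m = min (ennreal (norm x)) (radial_fun A (sgn x))"
    unfolding m_def by (simp add: min_less_iff_disj)
  then have "ennreal m \<le> ennreal (norm x)" by simp
  then have m': "0 \<le> m" "m \<le> norm x" by (auto simp: m_def)
  have iff: "x \<in> radial_sum A ((*\<^sub>R) \<alpha> ` cball 0 1) \<longleftrightarrow> norm x - m \<le> \<alpha>" if "\<alpha> > 0" for \<alpha>
  proof -
    have "x \<in> radial_sum A ((*\<^sub>R) \<alpha> ` cball 0 1) \<longleftrightarrow>
        ennreal (norm x) \<le> radial_fun A (sgn x) + ennreal \<alpha>"
      using star_body_scaleR_mem_iff[OF radial_sum(1) s, of "norm x"]
        radial_sum(2)[OF s] radial_fun_scaled_ball[OF s that] x by simp
    \<comment> \<open>Replacing rho_A by its truncation at |x| does not affect this inequality,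
      since it holds anyway once rho_A \<ge> |x|.\<close>
    also have "\<dots> \<longleftrightarrow> ennreal (norm x) \<le> ennreal m + ennreal \<alpha>"
      unfolding m by (auto simp: min_def intro: add_increasing2)
    also have "\<dots> \<longleftrightarrow> norm x - m \<le> \<alpha>"
      using that m' by (auto simp: ennreal_plus[symmetric] simp del: ennreal_plus)
    finally show ?thesis .
  qed
  \<comment> \<open>The condition \<alpha> > 0 excludes the endpoint exactly when
    \<open>norm x - m\<close> is 0; the infimum is \<open>norm x - m\<close> in both cases.\<close>
  have "{\<alpha>. \<alpha> > 0 \<and> x \<in> radial_sum A ((*\<^sub>R) \<alpha> ` cball 0 1)} =
      (if norm x - m > 0 then {norm x - m..} else {0<..})"
    using iff m' by auto
  then have "radial_dist x A = norm x - m"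
    using m' by (auto simp: radial_dist_def)
  then show ?thesis by (simp add: m_def)
qed

text \<open>Distance zero means |x| \<le> rho_A(x/|x|), which is membership because A is radially
  closed. Hence the distance function determines the star body.\<close>

lemma star_body_mem_iff_radial_dist:
  assumes "star_body A"
  shows "x \<in> A \<longleftrightarrow> radial_dist x A = 0"
proof (cases "x = 0")
  case True
  then show ?thesis
    using assms star_set_zero by (auto simp: star_body_def)
next
  case False
  then have s: "sgn x \<in> sphere 0 1" by (simp add: norm_sgn)
  have x: "norm x *\<^sub>R sgn x = x" using False by (simp add: sgn_div_norm)
  let ?r = "min (ennreal (norm x)) (radial_fun A (sgn x))"
  have "radial_dist x A = 0 \<longleftrightarrow> ?r = ennreal (norm x)"
    using radial_dist_eq[OF assms, of x] by (cases ?r) (auto simp: min_def)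
  then show ?thesis
    using star_body_scaleR_mem_iff[OF assms s, of "norm x"] x by (auto simp: min_def)
qed

lemma star_bodies_eqI:
  assumes "A \<in> star_bodies" "B \<in> star_bodies" "\<And>x. radial_dist x A = radial_dist x B"
  shows "A = B"
  using assms star_body_mem_iff_radial_dist[of A] star_body_mem_iff_radial_dist[of B]
  by (auto simp: star_bodies_def)

section \<open>The metric\<close>

text \<open>Both real suprema are genuine: the distances lie between 0 and |x|, so they differ by at
  most j on the ball of radius j, and the outer terms are at most 1. Later estimates use this form
  and avoid suprema.\<close>

lemma radial_AW_dist_le_iff:
  fixes A B :: "'a::real_normed_vector set"
  assumes "A \<in> star_bodies" "B \<in> star_bodies"
  shows "radial_AW_dist A B \<le> c \<longleftrightarrow>
    (\<forall>j\<ge>1. 1 / real j \<le> c \<or> (\<forall>x\<in>cball 0 (real j). \<bar>radial_dist x A - radial_dist x B\<bar> \<le> c))"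
proof -
  let ?D = "\<lambda>j::nat. SUP x\<in>cball (0::'a) (real j). \<bar>radial_dist x A - radial_dist x B\<bar>"
  have bdd: "bdd_above ((\<lambda>x. \<bar>radial_dist x A - radial_dist x B\<bar>) ` cball 0 (real j))" for j
  proof (rule bdd_aboveI2)
    fix x :: 'a assume "x \<in> cball 0 (real j)"
    then show "\<bar>radial_dist x A - radial_dist x B\<bar> \<le> real j"
      using radial_dist_nonneg[of x A] radial_dist_le_norm[of x A]
        radial_dist_nonneg[of x B] radial_dist_le_norm[of x B] by auto
  qed
  have "bdd_above ((\<lambda>j. min (1 / real j) (?D j)) ` {1..})"
    by (rule bdd_aboveI2[where M = 1]) (auto simp: min_le_iff_disj)
  then have "radial_AW_dist A B \<le> c \<longleftrightarrow> (\<forall>j\<in>{1..}. min (1 / real j) (?D j) \<le> c)"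
    using assms unfolding radial_AW_dist_def by (simp add: cSUP_le_iff)
  also have "\<dots> \<longleftrightarrow> (\<forall>j\<ge>1. 1 / real j \<le> c \<or> ?D j \<le> c)"
    by (simp add: min_le_iff_disj Ball_def)
  finally show ?thesis
    using cSUP_le_iff[OF _ bdd] by simp
qed

lemma radial_AW_dist_le_one:
  "A \<in> star_bodies \<Longrightarrow> B \<in> star_bodies \<Longrightarrow> radial_AW_dist A B \<le> 1"
  by (simp add: radial_AW_dist_le_iff)

text \<open>For j = 1, either the value is at least 1, or it bounds the difference at the origin,
  where both distances vanish.\<close>

lemma radial_AW_dist_nonneg: "0 \<le> radial_AW_dist A B"
proof (cases "A \<in> star_bodies \<and> B \<in> star_bodies")
  case True
  then have "1 / real 1 \<le> radial_AW_dist A B \<or>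
      (\<forall>x\<in>cball 0 (real 1). \<bar>radial_dist x A - radial_dist x B\<bar> \<le> radial_AW_dist A B)"
    using radial_AW_dist_le_iff[of A B "radial_AW_dist A B"] by blast
  then show ?thesis
    by (elim disjE) (auto dest: bspec[where x = 0])
qed (auto simp: radial_AW_dist_def)

text \<open>A value below e \<le> 1/j rules out the alternative 1/j \<le> c, which leaves the
  uniform bound on the ball.\<close>

lemma radial_dist_diff_less:
  assumes "A \<in> star_bodies" "B \<in> star_bodies" "1 \<le> j" "radial_AW_dist A B < e"
    "e \<le> 1 / real j" "x \<in> cball 0 (real j)"
  shows "\<bar>radial_dist x A - radial_dist x B\<bar> < e"
  using radial_AW_dist_le_iff[OF assms(1,2), of "radial_AW_dist A B"] assms(3-6) by force

text \<open>A single radius suffices: balls with j \<le> N lie inside the ball of radius N, and for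
  j > N one has 1/j \<le> 1/N \<le> c.\<close>

lemma radial_AW_dist_leI:
  assumes "A \<in> star_bodies" "B \<in> star_bodies" "1 \<le> N" "1 / real N \<le> c"
    and "\<And>x. x \<in> cball 0 (real N) \<Longrightarrow> \<bar>radial_dist x A - radial_dist x B\<bar> \<le> c"
  shows "radial_AW_dist A B \<le> c"
  unfolding radial_AW_dist_le_iff[OF assms(1,2)]
proof (intro allI impI)
  fix j :: nat assume j: "1 \<le> j"
  show "1 / real j \<le> c \<or> (\<forall>x\<in>cball 0 (real j). \<bar>radial_dist x A - radial_dist x B\<bar> \<le> c)"
  proof (cases "j \<le> N")
    case True
    then show ?thesis using assms(5) by auto
  next
    case False
    then have "1 / real j \<le> 1 / real N" using assms(3) by (simp add: frac_le)
    then show ?thesis using assms(4) by linarith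
  qed
qed

interpretation radial_AW: Metric_space star_bodies radial_AW_dist
proof
  show "0 \<le> radial_AW_dist A B" for A B :: "'a set"
    by (rule radial_AW_dist_nonneg)
  show "radial_AW_dist A B = radial_AW_dist B A" for A B :: "'a set"
    unfolding radial_AW_dist_def by (simp add: abs_minus_commute conj_commute)
next
  fix A B :: "'a set" assume AB: "A \<in> star_bodies" "B \<in> star_bodies"
  \<comment> \<open>With c = 0 the alternative 1/j \<le> 0 is impossible, so the distances agree on
    every ball.\<close>
  have "radial_dist x A = radial_dist x B" if "radial_AW_dist A B = 0" for x
  proof -
    obtain j :: nat where j: "max 1 (norm x) \<le> real j" using real_arch_simple by blast
    then show ?thesis
      using radial_AW_dist_le_iff[OF AB, of 0] that by force
  qed
  moreover have "radial_AW_dist A A \<le> 0"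
    using AB by (simp add: radial_AW_dist_le_iff)
  ultimately show "radial_AW_dist A B = 0 \<longleftrightarrow> A = B"
    using star_bodies_eqI[OF AB] radial_AW_dist_nonneg[of A A] by force
next
  fix A B C :: "'a set"
  assume ABC: "A \<in> star_bodies" "B \<in> star_bodies" "C \<in> star_bodies"
  let ?p = "radial_AW_dist A B" and ?q = "radial_AW_dist B C"
  show "radial_AW_dist A C \<le> ?p + ?q"
    unfolding radial_AW_dist_le_iff[OF ABC(1,3)]
  proof (intro allI impI)
    fix j :: nat assume j: "1 \<le> j"
    have "1 / real j \<le> ?p \<or> (\<forall>x\<in>cball 0 (real j). \<bar>radial_dist x A - radial_dist x B\<bar> \<le> ?p)"
      using radial_AW_dist_le_iff[OF ABC(1,2), of ?p] j by blast
    moreover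
    have "1 / real j \<le> ?q \<or> (\<forall>x\<in>cball 0 (real j). \<bar>radial_dist x B - radial_dist x C\<bar> \<le> ?q)"
      using radial_AW_dist_le_iff[OF ABC(2,3), of ?q] j by blast
    \<comment> \<open>If 1/j is below \<open>?p\<close> or \<open>?q\<close>, nonnegativity of the
      other one suffices; otherwise the triangle inequality holds pointwise on the ball.\<close>
    ultimately show "1 / real j \<le> ?p + ?q \<or>
        (\<forall>x\<in>cball 0 (real j). \<bar>radial_dist x A - radial_dist x C\<bar> \<le> ?p + ?q)"
      using radial_AW_dist_nonneg[of A B] radial_AW_dist_nonneg[of B C] by fastforce
  qed
qed

section \<open>Comparison of the topologies\<close>

lemma openin_radial_AW_topology:
  fixes U :: "'a::real_normed_vector set set"
  shows "openin radial_AW_topology U \<longleftrightarrow> U \<subseteq> star_bodies \<and>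
    (\<forall>A\<in>U. \<exists>B e. bounded B \<and> e > 0 \<and>
       {C \<in> star_bodies. \<forall>x\<in>B. \<bar>radial_dist x C - radial_dist x A\<bar> < e} \<subseteq> U)"
    (is "_ \<longleftrightarrow> ?R")
proof
  assume "openin radial_AW_topology U"
  then obtain V where V: "openin unif_conv_bounded_topology V"
    "U = (\<lambda>A x. radial_dist x A) -` V \<inter> star_bodies"
    unfolding radial_AW_topology_def openin_pullback_topology by blast
  show ?R
  proof (intro conjI ballI)
    fix A assume "A \<in> U"
    then have "(\<lambda>x. radial_dist x A) \<in> V" using V(2) by blast
    then obtain B e where
      "bounded B" "e > 0" "{g. \<forall>x\<in>B. \<bar>g x - radial_dist x A\<bar> < e} \<subseteq> V"
      using V(1)[unfolded openin_unif_conv_bounded_topology, rule_format] by meson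
    then show "\<exists>B e. bounded B \<and> e > 0 \<and>
       {C \<in> star_bodies. \<forall>x\<in>B. \<bar>radial_dist x C - radial_dist x A\<bar> < e} \<subseteq> U"
      unfolding V(2) by (intro exI[of _ B] exI[of _ e]) auto
  qed (use V(2) in blast)
next
  assume R: ?R
  \<comment> \<open>The sets of functions pointwise closer than e on B need not be open, since the
    differences may approach e. So \<open>V\<close> collects every g with such a neighbourhood whose
    distance functions all come from \<open>U\<close>.\<close>
  define V where "V = {g. \<exists>B e. bounded B \<and> e > 0 \<and>
    {C \<in> star_bodies. \<forall>x\<in>B. \<bar>radial_dist x C - g x\<bar> < e} \<subseteq> U}"
  have "openin unif_conv_bounded_topology V"
    unfolding openin_unif_conv_bounded_topology
  proof
    fix f assume "f \<in> V"
    then obtain B e where B: "bounded B" "e > 0"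
      "{C \<in> star_bodies. \<forall>x\<in>B. \<bar>radial_dist x C - f x\<bar> < e} \<subseteq> U"
      unfolding V_def by blast
    \<comment> \<open>Halving e leaves room for the triangle inequality: what is e/2-close to g is
      e-close to f on the same B.\<close>
    have "g \<in> V" if g: "\<forall>x\<in>B. \<bar>g x - f x\<bar> < e / 2" for g
    proof -
      have "C \<in> U" if C: "C \<in> star_bodies" "\<forall>x\<in>B. \<bar>radial_dist x C - g x\<bar> < e / 2" for C
      proof -
        have "\<forall>x\<in>B. \<bar>radial_dist x C - f x\<bar> < e"
          using g C(2) by (smt (verit) field_sum_of_halves)
        then show ?thesis using B(3) C(1) by blast
      qed
      then show ?thesis
        unfolding V_def using B by (intro CollectI exI[of _ B] exI[of _ "e / 2"]) auto
    qed
    then show "\<exists>B e. bounded B \<and> e > 0 \<and> {g. \<forall>x\<in>B. \<bar>g x - f x\<bar> < e} \<subseteq> V"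
      using B by (intro exI[of _ B] exI[of _ "e / 2"]) auto
  qed
  moreover have "U = (\<lambda>A x. radial_dist x A) -` V \<inter> star_bodies"
  proof (intro equalityI subsetI)
    fix A assume "A \<in> U"
    then show "A \<in> (\<lambda>A x. radial_dist x A) -` V \<inter> star_bodies"
      using R unfolding V_def by auto
  next
    fix A assume A: "A \<in> (\<lambda>A x. radial_dist x A) -` V \<inter> star_bodies"
    then obtain B e where "e > 0"
      "{C \<in> star_bodies. \<forall>x\<in>B. \<bar>radial_dist x C - radial_dist x A\<bar> < e} \<subseteq> U"
      unfolding V_def by blast
    then show "A \<in> U" using A by auto
  qed
  ultimately show "openin radial_AW_topology U"
    unfolding radial_AW_topology_def openin_pullback_topology by blast
qed

lemma mtopology_radial_AW: "radial_AW.mtopology = radial_AW_topology"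
proof (rule topology_eq[THEN iffD2], intro allI)
  fix U :: "'a set set"
  have "(\<exists>r>0. radial_AW.mball A r \<subseteq> U) \<longleftrightarrow> (\<exists>B e. bounded B \<and> e > 0 \<and>
       {C \<in> star_bodies. \<forall>x\<in>B. \<bar>radial_dist x C - radial_dist x A\<bar> < e} \<subseteq> U)"
    if A: "A \<in> star_bodies" for A
  proof
    assume "\<exists>r>0. radial_AW.mball A r \<subseteq> U"
    then obtain r where r: "r > 0" "radial_AW.mball A r \<subseteq> U" by blast
    \<comment> \<open>Using r/2 turns the non-strict bound on the metric into membership in the open
      ball of radius r.\<close>
    obtain N :: nat where N: "N > 0" "1 / real N < r / 2"
      using real_arch_inverse[of "r / 2"] r(1) by (auto simp: inverse_eq_divide)
    have "C \<in> U" if C: "C \<in> star_bodies"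
      "\<forall>x\<in>cball 0 (real N). \<bar>radial_dist x C - radial_dist x A\<bar> < r / 2" for C
    proof -
      have "radial_AW_dist A C \<le> r / 2"
        using N C A by (intro radial_AW_dist_leI[of _ _ N])
          (auto simp: abs_minus_commute less_imp_le)
      then show ?thesis using r A C(1) by auto
    qed
    then show "\<exists>B e. bounded B \<and> e > 0 \<and>
       {C \<in> star_bodies. \<forall>x\<in>B. \<bar>radial_dist x C - radial_dist x A\<bar> < e} \<subseteq> U"
      using r(1) by (intro exI[of _ "cball 0 (real N)"] exI[of _ "r / 2"]) auto
  next
    assume "\<exists>B e. bounded B \<and> e > 0 \<and>
       {C \<in> star_bodies. \<forall>x\<in>B. \<bar>radial_dist x C - radial_dist x A\<bar> < e} \<subseteq> U"
    then obtain B e where B: "bounded B" "e > 0"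
      "{C \<in> star_bodies. \<forall>x\<in>B. \<bar>radial_dist x C - radial_dist x A\<bar> < e} \<subseteq> U" by blast
    obtain b where b: "\<And>x. x \<in> B \<Longrightarrow> norm x \<le> b"
      using B(1) unfolding bounded_iff by blast
    obtain j :: nat where "max 1 b \<le> real j" using real_arch_simple by blast
    then have j: "1 \<le> j" "B \<subseteq> cball 0 (real j)" using b by force+
    \<comment> \<open>The cap 1/j makes the metric control the distances on the whole ball of radius
      j, which contains B.\<close>
    define r where "r = min e (1 / real j)"
    have "r > 0" using B(2) j(1) by (simp add: r_def)
    moreover have "C \<in> U" if C: "C \<in> star_bodies" "radial_AW_dist A C < r" for C
    proof -
      have "\<bar>radial_dist x A - radial_dist x C\<bar> < r" if "x \<in> B" for x
        using radial_dist_diff_less[OF A C(1) j(1) C(2)] j(2) that by (auto simp: r_def)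
      then have "\<forall>x\<in>B. \<bar>radial_dist x C - radial_dist x A\<bar> < e"
        by (auto simp: r_def abs_minus_commute)
      then show ?thesis using B(3) C(1) by blast
    qed
    ultimately show "\<exists>r>0. radial_AW.mball A r \<subseteq> U" by auto
  qed
  then show "openin radial_AW.mtopology U \<longleftrightarrow> openin radial_AW_topology U"
    unfolding openin_radial_AW_topology radial_AW.openin_mtopology by blast
qed

section \<open>Completeness\<close>

lemma radial_dist_limit_exists:
  fixes A :: "nat \<Rightarrow> 'a::real_normed_vector set"
  assumes A: "\<And>n. A n \<in> star_bodies" and lim: "\<And>x. (\<lambda>n. radial_dist x (A n)) \<longlonglongrightarrow> f x"
  shows "\<exists>C\<in>star_bodies. \<forall>x. radial_dist x C = f x"
proof -
  obtain C :: "'a set" where C: "star_body C"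
    "\<And>\<theta>. \<theta> \<in> sphere 0 1 \<Longrightarrow> radial_fun C \<theta> = liminf (\<lambda>n. radial_fun (A n) \<theta>)"
    using star_body_exists[of "\<lambda>\<theta>. liminf (\<lambda>n. radial_fun (A n) \<theta>)"] by blast
  have "radial_dist x C = f x" for x
  proof (cases "x = 0")
    case True
    then show ?thesis using lim[of 0] by (simp add: LIMSEQ_const_iff)
  next
    case False
    then have s: "sgn x \<in> sphere 0 1" by (simp add: norm_sgn)
    let ?h = "min (ennreal (norm x))"
    \<comment> \<open>This recovers the truncated radial function from the distance, so the
      truncations converge along the sequence.\<close>
    have "ennreal (norm x - radial_dist x (A n)) = ?h (radial_fun (A n) (sgn x))" for n
      using A[of n] by (subst radial_dist_eq) (auto simp: star_bodies_def min_less_iff_disj)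
    moreover have "(\<lambda>n. ennreal (norm x - radial_dist x (A n))) \<longlonglongrightarrow> ennreal (norm x - f x)"
      by (intro tendsto_ennrealI tendsto_intros lim)
    ultimately have "liminf (\<lambda>n. ?h (radial_fun (A n) (sgn x))) = ennreal (norm x - f x)"
      by (intro lim_imp_Liminf) simp_all
    moreover have "liminf (\<lambda>n. ?h (radial_fun (A n) (sgn x))) = ?h (radial_fun C (sgn x))"
      unfolding C(2)[OF s]
      by (rule Liminf_compose_continuous_mono)
        (auto intro!: continuous_intros monoI simp: min_le_iff_disj)
    \<comment> \<open>\<open>ennreal\<close> sends negative reals to 0, so this bound is what lets f
      x be read off from \<open>ennreal (norm x - f x)\<close>.\<close>
    moreover have "f x \<le> norm x"
      using lim[of x] radial_dist_le_norm by (intro LIMSEQ_le_const2) auto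
    ultimately show ?thesis using radial_dist_eq[OF C(1), of x] by simp
  qed
  then show ?thesis using C(1) by (auto simp: star_bodies_def)
qed

lemma mcomplete_radial_AW:
  "Metric_space.mcomplete (star_bodies :: 'a::real_normed_vector set set) radial_AW_dist"
  unfolding radial_AW.mcomplete_def
proof (intro allI impI)
  fix A :: "nat \<Rightarrow> 'a set"
  assume "radial_AW.MCauchy A"
  then have A: "\<And>n. A n \<in> star_bodies"
    and Cauchy: "\<And>e. e > 0 \<Longrightarrow> \<exists>N. \<forall>n n'. N \<le> n \<longrightarrow> N \<le> n' \<longrightarrow> radial_AW_dist (A n) (A n') < e"
    by (auto simp: radial_AW.MCauchy_def)
  have unif: "\<exists>N. \<forall>n\<ge>N. \<forall>n'\<ge>N. \<forall>x\<in>cball 0 (real j).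
      \<bar>radial_dist x (A n) - radial_dist x (A n')\<bar> < e" if "1 \<le> j" "e > 0" for j e
  proof -
    \<comment> \<open>Closeness below 1/j is required for the metric to bound the differences on the
      ball of radius j.\<close>
    have "min e (1 / real j) > 0" using that by simp
    from Cauchy[OF this] obtain N where
      N: "\<And>n n'. N \<le> n \<Longrightarrow> N \<le> n' \<Longrightarrow> radial_AW_dist (A n) (A n') < min e (1 / real j)" by blast
    then show ?thesis
      using radial_dist_diff_less[OF A A that(1) N]
      by (intro exI[of _ N]) (simp add: min_less_iff_conj)
  qed
  have "convergent (\<lambda>n. radial_dist x (A n))" for x
  proof -
    obtain j :: nat where "max 1 (norm x) \<le> real j" using real_arch_simple by blast
    then have "1 \<le> j" "x \<in> cball 0 (real j)" by auto
    then have "\<exists>N. \<forall>n\<ge>N. \<forall>n'\<ge>N. \<bar>radial_dist x (A n) - radial_dist x (A n')\<bar> < e"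
      if "e > 0" for e
      using unif[OF _ that, of j] by blast
    then show ?thesis
      unfolding Cauchy_convergent_iff[symmetric] Cauchy_def dist_real_def by blast
  qed
  then have lim: "(\<lambda>n. radial_dist x (A n)) \<longlonglongrightarrow> lim (\<lambda>n. radial_dist x (A n))" for x
    by (simp add: convergent_LIMSEQ_iff)
  obtain C where C: "C \<in> star_bodies"
    "\<And>x. radial_dist x C = lim (\<lambda>n. radial_dist x (A n))"
    using radial_dist_limit_exists[OF A lim] by blast
  have "\<exists>N. \<forall>n\<ge>N. radial_AW_dist (A n) C < e" if "e > 0" for e
  proof -
    obtain j :: nat where j: "j > 0" "1 / real j < e / 2"
      using real_arch_inverse[of "e / 2"] \<open>e > 0\<close> by (auto simp: inverse_eq_divide)
    then obtain N where N: "\<And>n n' x. N \<le> n \<Longrightarrow> N \<le> n' \<Longrightarrow> x \<in> cball 0 (real j) \<Longrightarrow>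
        \<bar>radial_dist x (A n) - radial_dist x (A n')\<bar> < e / 2"
      using unif[of j "e / 2"] \<open>e > 0\<close>
      by (metis Suc_leI One_nat_def half_gt_zero)
    have "radial_AW_dist (A n) C \<le> e / 2" if n: "N \<le> n" for n
    proof (rule radial_AW_dist_leI[OF A C(1)])
      fix x :: 'a assume x: "x \<in> cball 0 (real j)"
      \<comment> \<open>With n fixed, n' tends to infinity in the Cauchy estimate. The strict bound
        e/2 becomes non-strict in the limit and stays below e.\<close>
      have "(\<lambda>n'. \<bar>radial_dist x (A n) - radial_dist x (A n')\<bar>)
          \<longlonglongrightarrow> \<bar>radial_dist x (A n) - radial_dist x C\<bar>"
        unfolding C(2) by (intro tendsto_intros lim)
      then show "\<bar>radial_dist x (A n) - radial_dist x C\<bar> \<le> e / 2"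
        using N[OF n _ x] by (intro LIMSEQ_le_const2) (auto intro!: exI[of _ N] less_imp_le)
    qed (use j in auto)
    then show ?thesis using \<open>e > 0\<close> by (intro exI[of _ N]) force
  qed
  then have "limitin radial_AW.mtopology A C sequentially"
    using A C(1) by (simp add: radial_AW.limit_metric_sequentially)
  then show "\<exists>C. limitin radial_AW.mtopology A C sequentially" by blast
qed

theorem theorem4p3:
  assumes "CARD('d::finite) \<ge> 2"
  defines "S \<equiv> (star_bodies :: (real ^ 'd) set set)"
  shows "(\<forall>A1\<in>S. \<forall>A2\<in>S. radial_AW_dist A1 A2 \<in> {0..1})
    \<and> Metric_space S radial_AW_dist
    \<and> Metric_space.mtopology S radial_AW_dist = radial_AW_topology
    \<and> Metric_space.mcomplete S radial_AW_dist"
  unfolding S_def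
  using radial_AW_dist_nonneg radial_AW_dist_le_one radial_AW.Metric_space_axioms
    mtopology_radial_AW mcomplete_radial_AW by auto

end
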